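(* The function $p(n)=n^{-1/m(K_4)}=n^{-2/3}$ is the threshold for the property $G(n,p)\to\mathrm{TT}_3$.
   Context: $\mathrm{TT}_3$ is the transitive triangle (acyclic orientation of $K_3$). For a graph $G$, $G\to\mathrm{TT}_3$ means every orientation of $G$ contains a copy of $\mathrm{TT}_3$. $G(n,p)$ is the binomial random graph. $p(n)$ is a threshold if $\mathbb P[G(n,p)\to\mathrm{TT}_3]\to0$ when $p/p(n)\to0$ and $\to1$ when $p/p(n)\to\infty$. $m(G)=\max\{e(J)/v(J):J\subseteq G,\ v(J)\ge1\}$. *)

theory Defs
  imports "HOL-Probability.Probability"
begin

text \<open>Graphs and digraphs are pairs of a vertex set and a set of edges (as two-element sets)
  or arcs (as ordered pairs).\<close>

type_synonym 'a graph = "'a set \<times> 'a set set"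
type_synonym 'a digraph = "'a set \<times> ('a \<times> 'a) set"

abbreviation verts :: "'a set \<times> 'b \<Rightarrow> 'a set" where "verts \<equiv> fst"
abbreviation edges :: "'a graph \<Rightarrow> 'a set set" where "edges \<equiv> snd"
abbreviation arcs :: "'a digraph \<Rightarrow> ('a \<times> 'a) set" where "arcs \<equiv> snd"

definition all_pairs :: "'a set \<Rightarrow> 'a set set" where
  "all_pairs V = {e. e \<subseteq> V \<and> card e = 2}"

definition simple_graph :: "'a graph \<Rightarrow> bool" where
  "simple_graph G \<longleftrightarrow> finite (verts G) \<and> edges G \<subseteq> all_pairs (verts G)"

definition complete_graph :: "nat \<Rightarrow> nat graph" where
  "complete_graph n = ({..<n}, all_pairs {..<n})"

definition subgraph :: "'a graph \<Rightarrow> 'a graph \<Rightarrow> bool" where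
  "subgraph J G \<longleftrightarrow> simple_graph J \<and> verts J \<subseteq> verts G \<and> edges J \<subseteq> edges G"

definition max_density :: "'a graph \<Rightarrow> real" where
  "max_density G =
     Max {real (card (edges J)) / real (card (verts J)) | J. subgraph J G \<and> card (verts J) \<ge> 1}"

text \<open>The bijection says that every edge receives exactly one of its two directions.\<close>

definition orientation :: "'a graph \<Rightarrow> 'a digraph \<Rightarrow> bool" where
  "orientation G D \<longleftrightarrow> verts D = verts G \<and> bij_betw (\<lambda>(u, v). {u, v}) (arcs D) (edges G)"

text \<open>Copies are not required to be induced.\<close>

definition contains_copy :: "'a digraph \<Rightarrow> 'b digraph \<Rightarrow> bool" where
  "contains_copy D H \<longleftrightarrow>
     (\<exists>f. inj_on f (verts H) \<and> f ` verts H \<subseteq> verts D \<and>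
          (\<forall>(u, v) \<in> arcs H. (f u, f v) \<in> arcs D))"

definition TT3 :: "nat digraph" where
  "TT3 = ({0, 1, 2}, {(0, 1), (0, 2), (1, 2)})"

definition arrows :: "'a graph \<Rightarrow> 'b digraph \<Rightarrow> bool" where
  "arrows G H \<longleftrightarrow> (\<forall>D. orientation G D \<longrightarrow> contains_copy D H)"

text \<open>Meaningful for \<open>0 \<le> p \<le> 1\<close> only, since \<^const>\<open>bernoulli_pmf\<close> truncates its parameter.\<close>

definition gnp :: "nat \<Rightarrow> real \<Rightarrow> nat graph pmf" where
  "gnp n p =
     map_pmf (\<lambda>X. ({..<n}, {e \<in> all_pairs {..<n}. X e}))
       (Pi_pmf (all_pairs {..<n}) False (\<lambda>_. bernoulli_pmf p))"

definition is_threshold :: "(nat \<Rightarrow> real) \<Rightarrow> (nat graph \<Rightarrow> bool) \<Rightarrow> bool" where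
  "is_threshold p\<^sub>0 P \<longleftrightarrow>
     (\<forall>p :: nat \<Rightarrow> real. (\<forall>n. 0 \<le> p n \<and> p n \<le> 1) \<longrightarrow>
        ((\<lambda>n. p n / p\<^sub>0 n) \<longlonglongrightarrow> 0 \<longrightarrow>
           (\<lambda>n. measure_pmf.prob (gnp n (p n)) {G. P G}) \<longlonglongrightarrow> 0) \<and>
        (filterlim (\<lambda>n. p n / p\<^sub>0 n) at_top sequentially \<longrightarrow>
           (\<lambda>n. measure_pmf.prob (gnp n (p n)) {G. P G}) \<longlonglongrightarrow> 1))"

end

theory Submission
  imports Defs
begin

text \<open>
  If \<open>p\<close> is much larger than \<open>n\<close> to the \<open>-2/3\<close>, the second moment method yields a \<open>K\<^sub>4\<close>, and a
  vertex with two out-neighbours inside an oriented \<open>K\<^sub>4\<close> gives a transitive triangle.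

  If \<open>p\<close> is much smaller, the first moment method excludes 6 edges spanning 4 vertices, 8 edges
  spanning 5 vertices and 9 edges spanning 6 vertices. In a graph without these, triangles glued
  along edges form clusters of at most three triangles, so (if there is a triangle at all) some
  triangle has two edges that lie in no other triangle. Delete these two edges, orient the rest by
  induction, and orient the two edges so that the deleted triangle becomes cyclic.
\<close>

section \<open>Sparse graphs have orientations without transitive triangles\<close>

abbreviation orients :: "('a \<times> 'a) set \<Rightarrow> 'a set set \<Rightarrow> bool" where
  "orients A E \<equiv> bij_betw (\<lambda>(u, v). {u, v}) A E"

text \<open>Distinctness of the three vertices is left out: if two of them coincided, one of the
  arcs would be a loop, which orientations of simple graphs do not have.\<close>

definition TT3_free :: "('a \<times> 'a) set \<Rightarrow> bool" where
  "TT3_free A \<longleftrightarrow> (\<forall>u v w. \<not> ((u, v) \<in> A \<and> (u, w) \<in> A \<and> (v, w) \<in> A))"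

definition is_triangle :: "'a set set \<Rightarrow> 'a \<Rightarrow> 'a \<Rightarrow> 'a \<Rightarrow> bool" where
  "is_triangle E x y z \<longleftrightarrow> {x, y} \<in> E \<and> {y, z} \<in> E \<and> {x, z} \<in> E"

text \<open>Taking \<open>\<Union>F\<close> as the vertex set rules out isolated vertices, and
  \<open>F\<close> need not be an induced subgraph.\<close>

definition dense_spot :: "'a set set \<Rightarrow> nat \<Rightarrow> nat \<Rightarrow> bool" where
  "dense_spot E v e \<longleftrightarrow> (\<exists>F\<subseteq>E. card (\<Union>F) = v \<and> card F = e)"

text \<open>These three spots have expected counts of order at most n^4 p^6, n^5 p^8 and n^6 p^9,
  all vanishing when p is far below n^(-2/3).\<close>

definition sparse :: "'a set set \<Rightarrow> bool" where
  "sparse E \<longleftrightarrow> \<not> dense_spot E 4 6 \<and> \<not> dense_spot E 5 8 \<and> \<not> dense_spot E 6 9"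

lemma sparse_mono: "sparse E \<Longrightarrow> E' \<subseteq> E \<Longrightarrow> sparse E'"
  unfolding sparse_def dense_spot_def by (meson subset_trans)

text \<open>Explicit lists of vertices and edges reduce both cardinalities to distinctness goals
  that \<open>auto\<close> can settle.\<close>

lemma dense_spotI:
  assumes "distinct vs" "distinct (map (\<lambda>(u, v). {u, v}) es)" "length vs = v" "length es = e"
    and "set vs = fst ` set es \<union> snd ` set es" "\<forall>(x, y) \<in> set es. {x, y} \<in> E"
  shows "dense_spot E v e"
  unfolding dense_spot_def
proof (intro exI conjI)
  let ?F = "set (map (\<lambda>(u, v). {u, v}) es)"
  have "\<Union>?F = set vs" unfolding assms(5) by force
  then show "card (\<Union>?F) = v" using distinct_card[OF assms(1)] assms(3) by simp
  show "card ?F = e" using distinct_card[OF assms(2)] assms(4) by simp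
  show "?F \<subseteq> E" using assms(6) by auto
qed

lemma triangle_distinct:
  assumes "E \<subseteq> all_pairs UNIV" "is_triangle E x y z"
  shows "x \<noteq> y" "y \<noteq> z" "x \<noteq> z"
proof -
  have "p \<noteq> q" if "{p, q} \<in> E" for p q
    using assms(1) that by (auto simp: all_pairs_def)
  then show "x \<noteq> y" "y \<noteq> z" "x \<noteq> z" using assms(2) by (auto simp: is_triangle_def)
qed

lemma triangle_commute:
  "is_triangle E x y z \<longleftrightarrow> is_triangle E y x z" "is_triangle E x y z \<longleftrightarrow> is_triangle E x z y"
  by (auto simp: is_triangle_def insert_commute)

text \<open>The third argument is the apex of the triangle under consideration. An edge that is not
  \<open>shared\<close> can be deleted and later reoriented without affecting any other
  triangle.\<close>

definition shared :: "'a set set \<Rightarrow> 'a \<Rightarrow> 'a \<Rightarrow> 'a \<Rightarrow> bool" where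
  "shared E x y z \<longleftrightarrow> (\<exists>w. w \<noteq> z \<and> is_triangle E x y w)"

lemma shared_commute: "shared E x y z \<longleftrightarrow> shared E y x z"
  using triangle_commute unfolding shared_def by metis

text \<open>Three triangles in a strip, the middle one being \<open>a b c\<close>, have 7 edges on 5
  vertices. This is so close to a forbidden spot that no further triangle can be glued to the outer
  edges \<open>{a, d}\<close> and \<open>{b, d}\<close>.\<close>

lemma sparse_strip_maximal:
  assumes E: "E \<subseteq> all_pairs UNIV" and sp: "sparse E"
    and t: "is_triangle E a b c" "is_triangle E a b d" "is_triangle E a c e" and "d \<noteq> c" "e \<noteq> b"
  shows "\<not> shared E a d b" "\<not> shared E b d a"
proof -
  note n1 = triangle_distinct[OF E t(1)] triangle_distinct[OF E t(2)] triangle_distinct[OF E t(3)]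
  have es: "{a,b} \<in> E" "{b,c} \<in> E" "{a,c} \<in> E" "{a,d} \<in> E" "{b,d} \<in> E" "{a,e} \<in> E" "{c,e} \<in> E"
    using t by (auto simp: is_triangle_def)
  have no4: "\<not> dense_spot E 4 6" and no5: "\<not> dense_spot E 5 8" and no6: "\<not> dense_spot E 6 9"
    using sp by (auto simp: sparse_def)
  \<comment> \<open>If the two outer apexes coincided, they would form a K4 with \<open>a\<close>,
    \<open>b\<close>, \<open>c\<close>.\<close>
  have "d \<noteq> e"
  proof
    assume [simp]: "d = e"
    have "dense_spot E 4 6"
      by (rule dense_spotI[of "[a,b,c,e]" "[(a,b),(b,c),(a,c),(a,e),(b,e),(c,e)]"])
        (use n1 es assms in \<open>auto simp: doubleton_eq_iff\<close>)
    with no4 show False ..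
  qed
  note n = n1 this assms(6,7)
  \<comment> \<open>These are the only three of the ten pairs not yet known to be edges; any of them
    would be an eighth edge on five vertices.\<close>
  have no_chord: "{x, y} \<notin> E" if "(x, y) \<in> {(d, c), (d, e), (b, e)}" for x y
  proof
    assume xy: "{x, y} \<in> E"
    have "dense_spot E 5 8"
      by (rule dense_spotI[of "[a,b,c,d,e]" "[(x,y),(a,b),(b,c),(a,c),(a,d),(b,d),(a,e),(c,e)]"])
        (use n es xy that in \<open>auto simp: doubleton_eq_iff\<close>)
    with no5 show False ..
  qed
  \<comment> \<open>A new vertex \<open>f\<close> with two edges into the strip would give 9 edges
    on 6 vertices.\<close>
  have no_ext: False if f: "f \<notin> {a,b,c,d,e}" and "{d, f} \<in> E" "{x, f} \<in> E" "x \<in> {a, b}" for f x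
  proof -
    have "dense_spot E 6 9"
      by (rule dense_spotI[of "[a,b,c,d,e,f]"
            "[(d,f),(x,f),(a,b),(b,c),(a,c),(a,d),(b,d),(a,e),(c,e)]"])
        (use n es that in \<open>auto simp: doubleton_eq_iff\<close>)
    with no6 show False ..
  qed
  show "\<not> shared E a d b"
  proof
    assume "shared E a d b"
    then obtain f where f: "f \<noteq> b" "is_triangle E a d f" unfolding shared_def by blast
    note nf = triangle_distinct[OF E f(2)]
    have ef: "{d, f} \<in> E" "{a, f} \<in> E" using f(2) by (auto simp: is_triangle_def)
    \<comment> \<open>Either \<open>f\<close> lies outside the strip, or it is \<open>c\<close> or
      \<open>e\<close>, and then \<open>{d, f}\<close> is a chord.\<close>
    show False using no_ext[of f a] no_chord[of d f] ef nf f by auto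
  qed
  show "\<not> shared E b d a"
  proof
    assume "shared E b d a"
    then obtain f where f: "f \<noteq> a" "is_triangle E b d f" unfolding shared_def by blast
    note nf = triangle_distinct[OF E f(2)]
    have ef: "{d, f} \<in> E" "{b, f} \<in> E" using f(2) by (auto simp: is_triangle_def)
    show False using no_ext[of f b] no_chord[of d f] ef nf f by auto
  qed
qed

text \<open>Otherwise every triangle has two shared edges and so is the middle of a strip, whose
  outer triangles then have two edges that are not shared.\<close>

lemma sparse_leaf_triangle:
  assumes E: "E \<subseteq> all_pairs UNIV" and sp: "sparse E" and t: "is_triangle E a b c"
  obtains x y z where "is_triangle E x y z" "\<not> shared E x z y" "\<not> shared E y z x"
proof -
  have "\<exists>x y z. is_triangle E x y z \<and> \<not> shared E x z y \<and> \<not> shared E y z x"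
  proof (rule ccontr)
    assume "\<not> ?thesis"
    then have H: "shared E x z y \<or> shared E y z x" if "is_triangle E x y z" for x y z
      using that by blast
    have core: False if t: "is_triangle E x y z" and s: "shared E x y z" "shared E x z y" for x y z
    proof -
      obtain d e where de: "is_triangle E x y d" "is_triangle E x z e" "d \<noteq> z" "e \<noteq> y"
        using s unfolding shared_def by blast
      show False
        \<comment> \<open>In the outer triangle \<open>x y d\<close>, the edges
          \<open>{x, d}\<close> and \<open>{y, d}\<close> are both not shared, against
          \<open>H\<close>.\<close>
        using sparse_strip_maximal[OF E sp t de] H[OF de(1)] by blast
    qed
    show False
      \<comment> \<open>By \<open>H\<close> at least two edges of \<open>a b c\<close> are shared;
        \<open>core\<close> is applied at their common vertex.\<close>
      using core[of a b c] core[of b a c] core[of c a b] H[of a b c] H[of b c a] H[of a c b] t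
      by (metis triangle_commute shared_commute)
  qed
  then show ?thesis using that by blast
qed

lemma orients_cases:
  assumes "orients A E" "{x, y} \<in> E"
  shows "(x, y) \<in> A \<or> (y, x) \<in> A"
proof -
  obtain u v where "(u, v) \<in> A" "{u, v} = {x, y}"
    using assms unfolding bij_betw_def by fastforce
  then show ?thesis by (auto simp: doubleton_eq_iff)
qed

lemma orients_edge: "orients A E \<Longrightarrow> (x, y) \<in> A \<Longrightarrow> {x, y} \<in> E"
  unfolding bij_betw_def by force

text \<open>Opposite arcs have the same underlying edge, so injectivity would identify them and
  yield a loop.\<close>

lemma orients_asym:
  assumes "orients A E" "E \<subseteq> all_pairs UNIV" "(u, v) \<in> A"
  shows "(v, u) \<notin> A"
proof
  assume "(v, u) \<in> A"
  then have "(u, v) = (v, u)"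
    by (intro inj_onD[OF bij_betw_imp_inj_on[OF assms(1)]]) (use assms(3) in auto)
  then have "u = v" by (rule Pair_inject)
  then show False using orients_edge[OF assms(1,3)] assms(2) by (auto simp: all_pairs_def)
qed

lemma orients_exists:
  assumes "E \<subseteq> all_pairs UNIV"
  shows "\<exists>A. orients A E"
proof -
  have "\<exists>q. (case q of (u, v) \<Rightarrow> {u, v}) = e" if "e \<in> E" for e
  proof -
    have "card e = 2" using assms that by (auto simp: all_pairs_def)
    then obtain u v where "e = {u, v}" by (auto simp: card_2_iff)
    then show ?thesis by (intro exI[of _ "(u, v)"]) simp
  qed
  then obtain g where g: "\<And>e. e \<in> E \<Longrightarrow> (case g e of (u, v) \<Rightarrow> {u, v}) = e" by metis
  have "orients (g ` E) E"
    using g by (auto simp: bij_betw_def inj_on_def image_image)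
  then show ?thesis ..
qed

lemma sparse_TT3_free_orientation:
  assumes "finite E" "E \<subseteq> all_pairs UNIV" "sparse E"
  shows "\<exists>A. orients A E \<and> TT3_free A"
  using assms
proof (induction "card E" arbitrary: E rule: less_induct)
  case less
  note E = less.prems(2)
  show ?case
  proof (cases "\<exists>a b c. is_triangle E a b c")
    case False
    obtain A where A: "orients A E" using orients_exists[OF E] by blast
    have "TT3_free A"
      unfolding TT3_free_def using orients_edge[OF A] False unfolding is_triangle_def by blast
    with A show ?thesis by blast
  next
    case True
    then obtain x0 y0 z where leaf0: "is_triangle E x0 y0 z" "\<not> shared E x0 z y0" "\<not> shared E y0 z x0"
      using sparse_leaf_triangle[OF E less.prems(3)] by metis
    let ?E' = "E - {{x0, z}, {y0, z}}"
    have "card ?E' < card E"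
      using leaf0(1) less.prems(1) by (intro psubset_card_mono) (auto simp: is_triangle_def)
    moreover have "sparse ?E'" using sparse_mono[OF less.prems(3)] by auto
    ultimately obtain A where A: "orients A ?E'" "TT3_free A"
      using less.hyps[of ?E'] less.prems by auto
    note n0 = triangle_distinct[OF E leaf0(1)]
    have "{x0, y0} \<in> ?E'" using leaf0(1) n0 by (auto simp: is_triangle_def doubleton_eq_iff)
    then have "(x0, y0) \<in> A \<or> (y0, x0) \<in> A" using orients_cases[OF A(1)] by blast
    \<comment> \<open>The direction of the remaining edge is fixed by the induction hypothesis; its
      ends are renamed so that it runs from \<open>x\<close> to \<open>y\<close>.\<close>
    then obtain x y where xy: "(x, y) \<in> A" and "(x, y) = (x0, y0) \<or> (x, y) = (y0, x0)" by blast
    then have leaf: "is_triangle E x y z" "\<not> shared E x z y" "\<not> shared E y z x"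
      and A1: "orients A (E - {{x, z}, {y, z}})"
      using leaf0 A(1) triangle_commute(1)[of E x0 y0 z] by (auto simp: insert_commute)
    note n = triangle_distinct[OF E leaf(1)]
    \<comment> \<open>With these two arcs the deleted triangle becomes the directed cycle x, y,
      z.\<close>
    let ?A = "A \<union> {(y, z), (z, x)}"
    have "orients {(y, z), (z, x)} {{x, z}, {y, z}}"
      using n by (auto simp: bij_betw_def doubleton_eq_iff)
    from bij_betw_combine[OF A1 this] have "orients ?A ((E - {{x, z}, {y, z}}) \<union> {{x, z}, {y, z}})"
      by blast
    also have "(E - {{x, z}, {y, z}}) \<union> {{x, z}, {y, z}} = E"
      using leaf(1) by (auto simp: is_triangle_def)
    finally have o: "orients ?A E" .
    note anti = orients_asym[OF o E]
    have cyc: "(x, y) \<in> ?A" "(y, z) \<in> ?A" "(z, x) \<in> ?A" using xy by auto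
    have "TT3_free ?A"
      unfolding TT3_free_def
    proof (intro allI notI)
      fix u v w assume uvw: "(u, v) \<in> ?A \<and> (u, w) \<in> ?A \<and> (v, w) \<in> ?A"
      then have t: "is_triangle E u v w"
        using orients_edge[OF o] unfolding is_triangle_def by blast
      have "\<not> ((u, v) \<in> A \<and> (u, w) \<in> A \<and> (v, w) \<in> A)" using A(2) unfolding TT3_free_def by blast
      \<comment> \<open>A transitive triangle must use a new arc, and the only triangle through such
        an arc is \<open>x y z\<close>, which is cyclic.\<close>
      then consider "(u, v) \<in> {(y, z), (z, x)}" | "(u, w) \<in> {(y, z), (z, x)}"
        | "(v, w) \<in> {(y, z), (z, x)}"
        using uvw by blast
      moreover have "is_triangle E u w v" "is_triangle E v w u" using t triangle_commute[of E] by metis+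
      moreover have "q = x" if "is_triangle E y z q" for q using leaf(3) that by (auto simp: shared_def)
      moreover have "q = y" if "is_triangle E z x q" for q
        using leaf(2) that triangle_commute(1)[of E z x q] by (auto simp: shared_def)
      moreover note t uvw anti[OF cyc(1)] anti[OF cyc(2)] anti[OF cyc(3)]
      ultimately show False by cases (metis Pair_inject insertE singletonD)+
    qed
    with o show ?thesis by blast
  qed
qed

lemma sparse_not_arrows_TT3:
  assumes "simple_graph G" "sparse (edges G)"
  shows "\<not> arrows G TT3"
proof
  assume ar: "arrows G TT3"
  have "finite (edges G)"
    using assms(1) by (auto simp: simple_graph_def all_pairs_def intro: finite_subset[of _ "Pow (verts G)"])
  moreover have "edges G \<subseteq> all_pairs UNIV" using assms(1) by (auto simp: simple_graph_def all_pairs_def)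
  ultimately obtain A where A: "orients A (edges G)" "TT3_free A"
    using sparse_TT3_free_orientation assms(2) by blast
  have "orientation G (verts G, A)" using A(1) by (simp add: orientation_def)
  then have "contains_copy (verts G, A) TT3" using ar by (simp add: arrows_def)
  then show False using A(2) by (auto simp: contains_copy_def TT3_def TT3_free_def)
qed

section \<open>Orientations of K4\<close>

lemma K4_arrows_TT3:
  assumes "K \<subseteq> verts G" "card K = 4" "all_pairs K \<subseteq> edges G"
  shows "arrows G TT3"
  unfolding arrows_def
proof (intro allI impI)
  fix D assume D: "orientation G D"
  then have o: "orients (arcs D) (edges G)" and V: "verts D = verts G" by (auto simp: orientation_def)
  obtain a b c d where K: "K = {a, b, c, d}" and n: "a \<noteq> b" "a \<noteq> c" "a \<noteq> d" "b \<noteq> c" "b \<noteq> d" "c \<noteq> d"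
    using \<open>card K = 4\<close> by (auto simp: card_Suc_eq numeral_eq_Suc)
  have adj: "(x, y) \<in> arcs D \<or> (y, x) \<in> arcs D" if "x \<in> K" "y \<in> K" "x \<noteq> y" for x y
  proof -
    have "{x, y} \<in> edges G" using assms(3) that by (force simp: all_pairs_def)
    then show ?thesis by (rule orients_cases[OF o])
  qed
  have copy: "contains_copy D TT3"
    if "(x, y) \<in> arcs D" "(x, z) \<in> arcs D" "x \<in> K" "y \<in> K" "z \<in> K" "x \<noteq> y" "x \<noteq> z" "y \<noteq> z" for x y z
  proof -
    have cc: "contains_copy D TT3" if "(x, y) \<in> arcs D" "(x, z) \<in> arcs D" "(y, z) \<in> arcs D"
      "x \<in> K" "y \<in> K" "z \<in> K" "x \<noteq> y" "x \<noteq> z" "y \<noteq> z" for x y z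
      unfolding contains_copy_def TT3_def
      by (rule exI[of _ "(\<lambda>i::nat. if i = 0 then x else if i = 1 then y else z)"])
        (use that V assms(1) in \<open>auto simp: inj_on_def\<close>)
    \<comment> \<open>Whichever way the edge between the out-neighbours \<open>y\<close> and
      \<open>z\<close> points, the triangle is transitive.\<close>
    show ?thesis using cc[of x y z] cc[of x z y] adj[of y z] that by blast
  qed
  \<comment> \<open>Pigeonhole: six arcs have their tails among four vertices, so some vertex has
    two out-neighbours.\<close>
  have sm: "\<exists>x\<in>K. \<exists>y\<in>K. \<exists>z\<in>K. (x, y) \<in> arcs D \<and> (x, z) \<in> arcs D \<and> x \<noteq> y \<and> x \<noteq> z \<and> y \<noteq> z"
    using adj[of a b] adj[of a c] adj[of a d] adj[of b c] adj[of b d] adj[of c d] n K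
    by (smt (verit) insertCI)
  then show "contains_copy D TT3" using copy by blast
qed

section \<open>Pairs of vertices and the density of complete graphs\<close>

lemma finite_all_pairs [simp]: "finite V \<Longrightarrow> finite (all_pairs V)"
  by (rule finite_subset[of _ "Pow V"]) (auto simp: all_pairs_def)

lemma card_all_pairs: "finite V \<Longrightarrow> card (all_pairs V) = card V choose 2"
  unfolding all_pairs_def by (rule n_subsets)

lemma all_pairs_mono: "A \<subseteq> B \<Longrightarrow> all_pairs A \<subseteq> all_pairs B"
  by (auto simp: all_pairs_def)

lemma all_pairs_Int: "all_pairs (A \<inter> B) = all_pairs A \<inter> all_pairs B"
  by (auto simp: all_pairs_def)

text \<open>A subgraph on k vertices has density at most (k - 1) / 2, which increases with k, so the
  whole graph attains the maximum.\<close>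

lemma max_density_complete_graph:
  assumes "n \<ge> 1"
  shows "max_density (complete_graph n) = (real n - 1) / 2"
proof -
  let ?D = "{real (card (edges J)) / real (card (verts J)) | J.
      subgraph J (complete_graph n) \<and> card (verts J) \<ge> 1}"
  have choose2: "real (k choose 2) / real k = (real k - 1) / 2" if "k \<ge> 1" for k :: nat
    using that by (cases k) (auto simp: choose_two field_simps real_of_nat_div)
  have "?D \<subseteq> (\<lambda>J. real (card (edges J)) / real (card (verts J))) `
      (Pow {..<n} \<times> Pow (all_pairs {..<n}))"
    unfolding subgraph_def complete_graph_def by fastforce
  then have "finite ?D" by (rule finite_subset) auto
  moreover have "d \<le> (real n - 1) / 2" if dD: "d \<in> ?D" for d
  proof -
    obtain J where d: "d = real (card (edges J)) / real (card (verts J))" and V: "card (verts J) \<ge> 1"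
      and J: "subgraph J (complete_graph n)"
      using dD by blast
    have E: "edges J \<subseteq> all_pairs (verts J)" and fin: "finite (verts J)" and Vn: "verts J \<subseteq> {..<n}"
      using J by (auto simp: subgraph_def complete_graph_def simple_graph_def)
    have "real (card (edges J)) \<le> real (card (verts J) choose 2)"
      using card_mono[OF _ E] fin by (simp add: card_all_pairs)
    then have "d \<le> real (card (verts J) choose 2) / real (card (verts J))"
      unfolding d by (rule divide_right_mono) simp
    also have "\<dots> = (real (card (verts J)) - 1) / 2" by (rule choose2[OF V])
    also have "\<dots> \<le> (real n - 1) / 2" using card_mono[OF _ Vn] by simp
    finally show ?thesis .
  qed
  moreover have "(real n - 1) / 2 \<in> ?D"
    using assms choose2[OF assms]
    by (intro CollectI exI[of _ "complete_graph n"])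
      (auto simp: subgraph_def complete_graph_def simple_graph_def card_all_pairs)
  ultimately show ?thesis unfolding max_density_def by (intro Max_eqI) auto
qed

section \<open>First moment bounds in the random graph\<close>

lemma gnp_prob_edges:
  assumes "F \<subseteq> all_pairs {..<n}" "0 \<le> p" "p \<le> 1"
  shows "measure_pmf.prob (gnp n p) {G. F \<subseteq> edges G} = p ^ card F"
proof -
  let ?P = "all_pairs {..<n}"
  \<comment> \<open>The event is a box: coordinates in \<open>F\<close> are forced to be
    \<open>True\<close>, all others are free, so its probability is a product.\<close>
  let ?B = "\<lambda>e. if e \<in> F then {True} else UNIV"
  have "measure_pmf.prob (gnp n p) {G. F \<subseteq> edges G}
      = measure_pmf.prob (Pi_pmf ?P False (\<lambda>_. bernoulli_pmf p)) (Pi ?P ?B)"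
    unfolding gnp_def measure_map_pmf using assms(1)
    by (intro arg_cong[where f = "measure _"]) (auto simp: Pi_def)
  also have "\<dots> = (\<Prod>e\<in>?P. measure_pmf.prob (bernoulli_pmf p) (?B e))"
    by (rule measure_Pi_pmf_Pi) simp
  also have "\<dots> = (\<Prod>e\<in>?P. if e \<in> F then p else 1)"
    using assms by (intro prod.cong) (auto simp: measure_pmf_single)
  also have "\<dots> = p ^ card F"
    using assms(1) by (simp add: prod.If_cases Int_absorb1)
  finally show ?thesis .
qed

lemma gnp_support:
  assumes "G \<in> set_pmf (gnp n p)"
  shows "verts G = {..<n}" "simple_graph G"
  using assms by (auto simp: gnp_def simple_graph_def)

text \<open>Union bound over the possible spots: at most n^v choices of the vertex set, then at most
  2^(v choose 2) sets of pairs on it, each present with probability p^e.\<close>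

lemma gnp_prob_dense_spot:
  assumes "0 \<le> p" "p \<le> 1"
  shows "measure_pmf.prob (gnp n p) {G. dense_spot (edges G) v e}
      \<le> 2 ^ (v choose 2) * (real n ^ v * p ^ e)"
proof -
  let ?\<S> = "{S. S \<subseteq> {..<n} \<and> card S = v}"
  define I where "I = {F. F \<subseteq> all_pairs {..<n} \<and> card (\<Union>F) = v \<and> card F = e}"
  have "finite I" unfolding I_def by (rule finite_subset[of _ "Pow (all_pairs {..<n})"]) auto
  have "I \<subseteq> (\<Union>S\<in>?\<S>. Pow (all_pairs S))"
  proof
    fix F assume "F \<in> I"
    then have "\<Union>F \<in> ?\<S>" "F \<in> Pow (all_pairs (\<Union>F))" by (auto simp: I_def all_pairs_def)
    then show "F \<in> (\<Union>S\<in>?\<S>. Pow (all_pairs S))" by blast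
  qed
  then have "card I \<le> card (\<Union>S\<in>?\<S>. Pow (all_pairs S))"
    by (intro card_mono finite_UN_I) (auto simp: finite_subset[of _ "{..<n}"])
  also have "\<dots> \<le> (\<Sum>S\<in>?\<S>. card (Pow (all_pairs S)))"
    by (rule card_UN_le) simp
  also have "\<dots> = (\<Sum>S\<in>?\<S>. 2 ^ (v choose 2))"
    by (intro sum.cong refl) (auto simp: card_Pow card_all_pairs finite_subset[of _ "{..<n}"])
  also have "\<dots> = (n choose v) * 2 ^ (v choose 2)"
    by (simp add: n_subsets)
  also have "\<dots> \<le> n ^ v * 2 ^ (v choose 2)"
    by (cases "v \<le> n") (auto simp: binomial_le_pow binomial_eq_0)
  finally have card_I: "card I \<le> n ^ v * 2 ^ (v choose 2)" .
  have "measure_pmf.prob (gnp n p) {G. dense_spot (edges G) v e}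
      \<le> measure_pmf.prob (gnp n p) (\<Union>F\<in>I. {G. F \<subseteq> edges G})"
  \<comment> \<open>The inclusion holds only on the support, where all edges are pairs from
    \<open>{..<n}\<close>.\<close>
  proof (rule measure_pmf.finite_measure_mono_AE)
    show "AE G in measure_pmf (gnp n p). G \<in> {G. dense_spot (edges G) v e}
        \<longrightarrow> G \<in> (\<Union>F\<in>I. {G. F \<subseteq> edges G})"
      unfolding AE_measure_pmf_iff
    proof (intro ballI impI)
      fix G assume G: "G \<in> set_pmf (gnp n p)" and "G \<in> {G. dense_spot (edges G) v e}"
      then obtain F where F: "F \<subseteq> edges G" "card (\<Union>F) = v" "card F = e"
        by (auto simp: dense_spot_def)
      moreover have "edges G \<subseteq> all_pairs {..<n}" using gnp_support[OF G] by (auto simp: simple_graph_def)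
      ultimately have "F \<in> I" unfolding I_def by blast
      with F(1) show "G \<in> (\<Union>F\<in>I. {G. F \<subseteq> edges G})" by blast
    qed
  qed simp
  also have "\<dots> \<le> (\<Sum>F\<in>I. measure_pmf.prob (gnp n p) {G. F \<subseteq> edges G})"
    using \<open>finite I\<close> by (intro measure_pmf.finite_measure_subadditive_finite) auto
  also have "\<dots> = (\<Sum>F\<in>I. p ^ e)"
    using assms by (intro sum.cong refl) (auto simp: I_def gnp_prob_edges)
  also have "\<dots> \<le> real (n ^ v * 2 ^ (v choose 2)) * p ^ e"
    unfolding sum_constant using card_I assms(1) by (intro mult_right_mono of_nat_mono) auto
  finally show ?thesis by (simp add: mult_ac)
qed

section \<open>The second moment method and copies of K4\<close>

text \<open>Chebyshev for the number \<open>X\<close> of events that occur: if none does,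
  \<open>X\<close> deviates from its mean by the whole mean. The numerator is the variance of
  \<open>X\<close>, written as a sum of covariances.\<close>

lemma (in prob_space) prob_no_event_le:
  assumes "finite I" and A: "\<And>i. i \<in> I \<Longrightarrow> A i \<in> events"
    and pos: "0 < (\<Sum>i\<in>I. prob (A i))"
  shows "prob {x \<in> space M. \<forall>i\<in>I. x \<notin> A i}
     \<le> (\<Sum>i\<in>I. \<Sum>j\<in>I. prob (A i \<inter> A j) - prob (A i) * prob (A j)) / (\<Sum>i\<in>I. prob (A i))\<^sup>2"
proof -
  define X :: "'a \<Rightarrow> real" where "X = (\<lambda>x. \<Sum>i\<in>I. indicator (A i) x)"
  define \<mu> where "\<mu> = (\<Sum>i\<in>I. prob (A i))"
  have [measurable]: "random_variable borel X"
    unfolding X_def using A by measurable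
  have X2: "(X x)\<^sup>2 = (\<Sum>i\<in>I. \<Sum>j\<in>I. indicator (A i \<inter> A j) x)" for x
    by (simp add: X_def power2_eq_square sum_product indicator_inter_arith)
  have Xint: "integrable M X" unfolding X_def using A
    by (intro Bochner_Integration.integrable_sum) (auto simp: emeasure_eq_measure)
  have X2int: "integrable M (\<lambda>x. (X x)\<^sup>2)" unfolding X2 using A
    by (intro Bochner_Integration.integrable_sum) (auto simp: emeasure_eq_measure)
  have AAint: "integrable M (indicat_real (A i \<inter> A j))" if "i \<in> I" "j \<in> I" for i j
    using A that by (auto simp: emeasure_eq_measure)
  have EX: "expectation X = \<mu>"
    unfolding X_def \<mu>_def using A
    by (subst Bochner_Integration.integral_sum) (auto simp: emeasure_eq_measure)
  have EX2: "expectation (\<lambda>x. (X x)\<^sup>2) = (\<Sum>i\<in>I. \<Sum>j\<in>I. prob (A i \<inter> A j))"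
  proof -
    have "expectation (\<lambda>x. (X x)\<^sup>2) = (\<Sum>i\<in>I. expectation (\<lambda>x. \<Sum>j\<in>I. indicator (A i \<inter> A j) x))"
      unfolding X2 by (intro Bochner_Integration.integral_sum Bochner_Integration.integrable_sum AAint)
    also have "\<dots> = (\<Sum>i\<in>I. \<Sum>j\<in>I. expectation (indicator (A i \<inter> A j)))"
      by (intro sum.cong refl Bochner_Integration.integral_sum AAint)
    also have "\<dots> = (\<Sum>i\<in>I. \<Sum>j\<in>I. prob (A i \<inter> A j))"
      using A by (intro sum.cong refl) auto
    finally show ?thesis .
  qed
  have "prob {x \<in> space M. \<forall>i\<in>I. x \<notin> A i} \<le> prob {x \<in> space M. \<mu> \<le> \<bar>X x - expectation X\<bar>}"
  proof (rule finite_measure_mono)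
    have "X x = 0" if "\<forall>i\<in>I. x \<notin> A i" for x using that by (simp add: X_def)
    then show "{x \<in> space M. \<forall>i\<in>I. x \<notin> A i} \<subseteq> {x \<in> space M. \<mu> \<le> \<bar>X x - expectation X\<bar>}"
      by (auto simp: EX)
  qed measurable
  also have "\<dots> \<le> variance X / \<mu>\<^sup>2"
    using pos by (intro Chebyshev_inequality X2int) (auto simp: \<mu>_def)
  also have "variance X = expectation (\<lambda>x. (X x)\<^sup>2) - (expectation X)\<^sup>2"
    by (rule variance_eq[OF Xint X2int])
  also have "\<dots> = (\<Sum>i\<in>I. \<Sum>j\<in>I. prob (A i \<inter> A j)) - \<mu>\<^sup>2"
    by (simp only: EX EX2)
  also have "\<dots> = (\<Sum>i\<in>I. \<Sum>j\<in>I. prob (A i \<inter> A j) - prob (A i) * prob (A j))"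
    by (simp add: \<mu>_def power2_eq_square sum_product sum_subtractf)
  finally show ?thesis by (simp add: \<mu>_def)
qed

text \<open>\<open>L\<close> is determined by its trace on \<open>K\<close> and by the m - k
  elements outside \<open>K\<close>.\<close>

lemma card_subsets_inter_le:
  assumes "finite V" "finite K"
  shows "card {L. L \<subseteq> V \<and> card L = m \<and> card (K \<inter> L) = k} \<le> 2 ^ card K * card V ^ (m - k)"
proof -
  let ?\<L> = "{L. L \<subseteq> V \<and> card L = m \<and> card (K \<inter> L) = k}"
  let ?\<U> = "{U. U \<subseteq> V \<and> card U = m - k}"
  have "inj_on (\<lambda>L. (K \<inter> L, L - K)) ?\<L>" by (rule inj_onI) blast
  moreover have "(\<lambda>L. (K \<inter> L, L - K)) ` ?\<L> \<subseteq> Pow K \<times> ?\<U>"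
    using assms by (auto simp: card_Diff_subset_Int Int_commute finite_subset)
  ultimately have "card ?\<L> \<le> card (Pow K \<times> ?\<U>)"
    using assms by (intro card_inj_on_le) auto
  also have "\<dots> = 2 ^ card K * (card V choose (m - k))"
    using assms by (simp add: card_cartesian_product card_Pow n_subsets)
  also have "\<dots> \<le> 2 ^ card K * card V ^ (m - k)"
    by (cases "m - k \<le> card V") (auto simp: binomial_le_pow binomial_eq_0)
  finally show ?thesis .
qed

text \<open>The summand for k comes from pairs of 4-sets meeting in k vertices. The constant is 16 *
  256: 2^4 traces on a 4-set, and 4^4 from bounding the number of 4-sets below.\<close>

lemma gnp_prob_no_K4:
  assumes p: "0 < p" "p \<le> 1" and n: "4 \<le> n"
  shows "measure_pmf.prob (gnp n p) {G. \<forall>K. K \<subseteq> {..<n} \<and> card K = 4 \<longrightarrow> \<not> all_pairs K \<subseteq> edges G}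
     \<le> 4096 * (\<Sum>k\<in>{2,3,4}. 1 / (real n ^ k * p ^ (k choose 2)))"
proof -
  let ?P = "measure_pmf.prob (gnp n p)"
  let ?T = "\<Sum>k\<in>{2,3,4}. 16 * real n ^ (4 - k) * p ^ (12 - (k choose 2))"
  let ?t = "\<lambda>k. 16 * real n ^ (4 - k) / p ^ (k choose 2)"
  define I where "I = {K. K \<subseteq> {..<n} \<and> card K = 4}"
  define A :: "nat set \<Rightarrow> nat graph set" where "A = (\<lambda>K. {G. all_pairs K \<subseteq> edges G})"
  have fin: "finite I" unfolding I_def by (rule finite_subset[of _ "Pow {..<n}"]) auto
  have finK: "finite K" if "K \<in> I" for K using that by (auto simp: I_def intro: finite_subset)
  have card6: "card (all_pairs K) = 6" if "K \<in> I" for K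
    using that finK[OF that] by (simp add: card_all_pairs I_def choose_two)
  have sub: "all_pairs K \<subseteq> all_pairs {..<n}" if "K \<in> I" for K
    using that by (intro all_pairs_mono) (auto simp: I_def)
  have probA: "?P (A K) = p ^ 6" if "K \<in> I" for K
    unfolding A_def using gnp_prob_edges[OF sub[OF that] less_imp_le[OF p(1)] p(2)] card6[OF that] by simp
  \<comment> \<open>The indicator sum over k allows pairs to be grouped later by the size of their
    intersection.\<close>
  have cov: "?P (A K \<inter> A L) - ?P (A K) * ?P (A L)
      \<le> (\<Sum>k\<in>{2,3,4}. if card (K \<inter> L) = k then p ^ (12 - (k choose 2)) else 0)" (is "_ \<le> ?R")
    if K: "K \<in> I" and L: "L \<in> I" for K L
  proof -
    let ?k = "card (K \<inter> L)"
    have "card (all_pairs K \<union> all_pairs L) + card (all_pairs K \<inter> all_pairs L) = 6 + 6"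
      using card_Un_Int[of "all_pairs K" "all_pairs L"] finK K L card6 by simp
    moreover have "card (all_pairs K \<inter> all_pairs L) = ?k choose 2"
      using finK[OF K] by (simp add: card_all_pairs flip: all_pairs_Int)
    ultimately have cardU: "card (all_pairs K \<union> all_pairs L) = 12 - (?k choose 2)" by simp
    have "A K \<inter> A L = {G. all_pairs K \<union> all_pairs L \<subseteq> edges G}" by (auto simp: A_def)
    then have pKL: "?P (A K \<inter> A L) = p ^ (12 - (?k choose 2))"
      using gnp_prob_edges[of "all_pairs K \<union> all_pairs L" n p] sub K L p cardU by simp
    have "?k \<le> card K" using finK[OF K] by (intro card_mono) auto
    then have "?k \<le> 4" using K by (simp add: I_def)
    then consider "?k < 2" | "?k \<in> {2,3,4}" by force
    then show ?thesis
    proof cases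
      case 1
      \<comment> \<open>At most one common vertex means no common edge: the events are independent
        and the covariance is zero.\<close>
      then show ?thesis using probA K L pKL by (simp add: binomial_eq_0 flip: power_add)
    next
      case 2
      then have "?R = ?P (A K \<inter> A L)" using pKL by auto
      then show ?thesis using probA K L p by simp
    qed
  qed
  have inner: "(\<Sum>L\<in>I. ?P (A K \<inter> A L) - ?P (A K) * ?P (A L))
      \<le> ?T" if K: "K \<in> I" for K
  proof -
    have "(\<Sum>L\<in>I. ?P (A K \<inter> A L) - ?P (A K) * ?P (A L))
        \<le> (\<Sum>L\<in>I. \<Sum>k\<in>{2,3,4}. if card (K \<inter> L) = k then p ^ (12 - (k choose 2)) else 0)"
      by (intro sum_mono cov K)
    also have "\<dots> = (\<Sum>k\<in>{2,3,4}. \<Sum>L\<in>I. if card (K \<inter> L) = k then p ^ (12 - (k choose 2)) else 0)"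
      by (rule sum.swap)
    also have "\<dots> = (\<Sum>k\<in>{2,3,4}. real (card {L \<in> I. card (K \<inter> L) = k}) * p ^ (12 - (k choose 2)))"
      using fin by (intro sum.cong refl) (simp add: sum.If_cases Int_def)
    also have "\<dots> \<le> ?T"
    proof (intro sum_mono mult_right_mono)
      fix k :: nat
      have "card {L \<in> I. card (K \<inter> L) = k} \<le> 16 * n ^ (4 - k)"
        using card_subsets_inter_le[of "{..<n}" K 4 k] finK[OF K] K by (simp add: I_def conj_assoc)
      then have "real (card {L \<in> I. card (K \<inter> L) = k}) \<le> real (16 * n ^ (4 - k))"
        by (rule of_nat_mono)
      then show "real (card {L \<in> I. card (K \<inter> L) = k}) \<le> 16 * real n ^ (4 - k)" by simp
    qed (use p in auto)
    finally show ?thesis .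
  qed
  define N where "N = real (card I)"
  \<comment> \<open>This is the bound (n choose 4) \<ge> (n / 4)^4.\<close>
  have N: "real n ^ 4 / 256 \<le> N"
    using binomial_ge_n_over_k_pow_k[OF n, where 'a = real]
    by (simp add: N_def I_def n_subsets power_divide)
  have n0: "real n > 0" using n by simp
  then have N0: "N > 0" using N by (smt (verit) divide_pos_pos zero_less_power)
  have mean: "(\<Sum>K\<in>I. ?P (A K)) = N * p ^ 6" using probA by (simp add: N_def)
  have "?P {G. \<forall>K. K \<subseteq> {..<n} \<and> card K = 4 \<longrightarrow> \<not> all_pairs K \<subseteq> edges G}
      = ?P {G \<in> space (measure_pmf (gnp n p)). \<forall>K\<in>I. G \<notin> A K}"
    by (intro arg_cong[where f = ?P]) (auto simp: I_def A_def)
  also have "\<dots> \<le> (\<Sum>K\<in>I. \<Sum>L\<in>I. ?P (A K \<inter> A L) - ?P (A K) * ?P (A L)) / (N * p ^ 6)\<^sup>2"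
    using measure_pmf.prob_no_event_le[OF fin, of A "gnp n p"] mean N0 p by simp
  also have "\<dots> \<le> (\<Sum>K\<in>I. ?T) / (N * p ^ 6)\<^sup>2"
    by (intro divide_right_mono sum_mono inner) simp_all
  also have "\<dots> = N * ?T / (N * p ^ 6)\<^sup>2" by (simp only: sum_constant N_def)
  \<comment> \<open>The factor \<open>p ^ 12\<close> is split off to cancel against the squared mean
    \<open>(N * p ^ 6)\<^sup>2\<close>.\<close>
  also have "?T = (\<Sum>k\<in>{2,3,4}. ?t k * p ^ 12)"
  proof (rule sum.cong[OF refl])
    fix k :: nat assume "k \<in> {2,3,4}"
    then have "k choose 2 \<le> 12" by (auto simp: choose_two)
    then have "p ^ 12 = p ^ (12 - (k choose 2)) * p ^ (k choose 2)" by (simp flip: power_add)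
    then show "16 * real n ^ (4 - k) * p ^ (12 - (k choose 2)) = ?t k * p ^ 12" using p by simp
  qed
  also have "\<dots> = sum ?t {2,3,4} * p ^ 12" by (rule sum_distrib_right[symmetric])
  also have "N * (sum ?t {2,3,4} * p ^ 12) / (N * p ^ 6)\<^sup>2 = sum ?t {2,3,4} * (1 / N)"
    using N0 p by (simp only: power_mult_distrib flip: power_mult) (simp add: power2_eq_square)
  also have "\<dots> \<le> sum ?t {2,3,4} * (256 / real n ^ 4)"
    using N N0 n0 p by (intro mult_left_mono sum_nonneg) (auto simp: field_simps)
  also have "\<dots> = (\<Sum>k\<in>{2,3,4}. ?t k * (256 / real n ^ 4))" by (rule sum_distrib_right)
  also have "\<dots> = (\<Sum>k\<in>{2,3,4}. 4096 * (1 / (real n ^ k * p ^ (k choose 2))))"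
  proof (rule sum.cong[OF refl])
    fix k :: nat assume "k \<in> {2,3,4}"
    then have "real n ^ 4 = real n ^ (4 - k) * real n ^ k" by (auto simp flip: power_add)
    then show "?t k * (256 / real n ^ 4) = 4096 * (1 / (real n ^ k * p ^ (k choose 2)))"
      using n0 by simp
  qed
  also have "\<dots> = 4096 * (\<Sum>k\<in>{2,3,4}. 1 / (real n ^ k * p ^ (k choose 2)))"
    by (rule sum_distrib_left[symmetric])
  finally show ?thesis .
qed

section \<open>Probability bounds around n^(-2/3) and the threshold\<close>

lemma powr_minus_two_thirds:
  assumes "n \<ge> 1"
  defines "q \<equiv> real n powr (- 2 / 3)"
  shows "0 < q" "q \<le> 1" "real n ^ 2 * q ^ 3 = 1" "real n * q ^ 2 \<le> 1"
proof -
  show 0: "0 < q" using assms by simp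
  show 1: "q \<le> 1" using assms powr_mono[of "-2/3" 0 "real n"] by simp
  have "q ^ 3 = real n powr (- 2)"
    using assms by (simp add: q_def powr_powr flip: powr_numeral)
  then show 3: "real n ^ 2 * q ^ 3 = 1"
    using assms by (simp add: powr_minus powr_numeral)
  \<comment> \<open>Squaring avoids a further fractional power: n^2 q^4 equals q, which is at most
    1.\<close>
  have "(real n * q ^ 2) ^ 2 = (real n ^ 2 * q ^ 3) * q" by (simp add: eval_nat_numeral)
  also have "\<dots> \<le> 1" using 1 3 by simp
  finally show "real n * q ^ 2 \<le> 1" by (simp add: power2_le_iff_abs_le abs_square_le_1)
qed

text \<open>The exponents 6, 10, 15 of 2 are (v choose 2) for v = 4, 5, 6. The powers of n cancel
  through n^2 q^3 = 1, apart from a factor n q^2 \<le> 1 in the middle term.\<close>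

lemma gnp_prob_arrows_le:
  assumes c: "0 \<le> c" and p: "p = c * real n powr (- 2 / 3)" "p \<le> 1" and n: "n \<ge> 1"
  shows "measure_pmf.prob (gnp n p) {G. arrows G TT3} \<le> 2 ^ 6 * c ^ 6 + 2 ^ 10 * c ^ 8 + 2 ^ 15 * c ^ 9"
proof -
  define q where "q = real n powr (- 2 / 3)"
  note q = powr_minus_two_thirds[OF n, folded q_def]
  have pq: "p = c * q" and p0: "0 \<le> p" using p c q by (auto simp: q_def)
  let ?D = "\<lambda>v e. {G :: nat graph. dense_spot (edges G) v e}"
  let ?P = "measure_pmf.prob (gnp n p)"
  have "?P {G. arrows G TT3} \<le> ?P (?D 4 6 \<union> ?D 5 8 \<union> ?D 6 9)"
  proof (rule measure_pmf.finite_measure_mono_AE)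
    show "AE G in measure_pmf (gnp n p). G \<in> {G. arrows G TT3} \<longrightarrow> G \<in> ?D 4 6 \<union> ?D 5 8 \<union> ?D 6 9"
      unfolding AE_measure_pmf_iff
    proof (intro ballI impI)
      fix G assume "G \<in> set_pmf (gnp n p)" "G \<in> {G. arrows G TT3}"
      then have "\<not> sparse (edges G)" using gnp_support(2) sparse_not_arrows_TT3 by blast
      then show "G \<in> ?D 4 6 \<union> ?D 5 8 \<union> ?D 6 9" by (auto simp: sparse_def)
    qed
  qed simp
  also have "\<dots> \<le> ?P (?D 4 6) + ?P (?D 5 8) + ?P (?D 6 9)"
    using measure_Un_le[of "?D 4 6 \<union> ?D 5 8" "gnp n p" "?D 6 9"]
      measure_Un_le[of "?D 4 6" "gnp n p" "?D 5 8"] by simp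
  also have "\<dots> \<le> 2 ^ 6 * (real n ^ 4 * p ^ 6) + 2 ^ 10 * (real n ^ 5 * p ^ 8) + 2 ^ 15 * (real n ^ 6 * p ^ 9)"
    using gnp_prob_dense_spot[OF p0 p(2), of n 4 6] gnp_prob_dense_spot[OF p0 p(2), of n 5 8]
      gnp_prob_dense_spot[OF p0 p(2), of n 6 9] by (simp add: choose_two)
  also have "real n ^ 4 * p ^ 6 = c ^ 6 * (real n ^ 2 * q ^ 3) ^ 2"
    by (simp add: pq power_mult_distrib flip: power_mult)
  also have "real n ^ 5 * p ^ 8 = c ^ 8 * (real n ^ 2 * q ^ 3) ^ 2 * (real n * q ^ 2)"
    by (simp add: pq power_mult_distrib eval_nat_numeral)
  also have "real n ^ 6 * p ^ 9 = c ^ 9 * (real n ^ 2 * q ^ 3) ^ 3"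
    by (simp add: pq power_mult_distrib flip: power_mult)
  finally have "?P {G. arrows G TT3} \<le> 2 ^ 6 * c ^ 6 + 2 ^ 10 * (c ^ 8 * (real n * q ^ 2)) + 2 ^ 15 * c ^ 9"
    by (simp add: q(3))
  also have "\<dots> \<le> 2 ^ 6 * c ^ 6 + 2 ^ 10 * (c ^ 8 * 1) + 2 ^ 15 * c ^ 9"
    using c q(4) by (intro add_mono mult_left_mono order_refl) auto
  finally show ?thesis by simp
qed

text \<open>Each of the three terms in the bound for missing K4 is at most 1 / c, and 12288 = 3 *
  4096.\<close>

lemma gnp_prob_arrows_ge:
  assumes c: "1 \<le> c" and p: "p = c * real n powr (- 2 / 3)" "p \<le> 1" and n: "n \<ge> 4"
  shows "measure_pmf.prob (gnp n p) {G. arrows G TT3} \<ge> 1 - 12288 / c"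
proof -
  define q where "q = real n powr (- 2 / 3)"
  have n1: "n \<ge> 1" using n by simp
  note q = powr_minus_two_thirds[OF n1, folded q_def]
  have pq: "p = c * q" and p0: "0 < p" using p c q by (auto simp: q_def)
  let ?P = "measure_pmf.prob (gnp n p)"
  let ?N = "{G :: nat graph. \<forall>K. K \<subseteq> {..<n} \<and> card K = 4 \<longrightarrow> \<not> all_pairs K \<subseteq> edges G}"
  have cpow: "c \<le> c ^ k" if "k \<ge> 1" for k using power_increasing[OF that c] by simp
  have "1 / (real n ^ k * p ^ (k choose 2)) \<le> 1 / c" if "k \<in> {2,3,4}" for k :: nat
  proof -
    \<comment> \<open>Since q \<le> 1, n^2 q is at least n^2 q^3 = 1.\<close>
    have "c \<le> real n ^ 2 * p"
    proof -
      have "c = c * (real n ^ 2 * q ^ 3)" using q by simp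
      also have "\<dots> \<le> c * (real n ^ 2 * q ^ 1)"
        using c q power_decreasing[of 1 3 q] by (intro mult_left_mono) auto
      finally show ?thesis by (simp add: pq mult_ac)
    qed
    moreover have "c \<le> real n ^ 3 * p ^ 3"
    proof -
      have "c \<le> c ^ 3" by (rule cpow) simp
      also have "\<dots> \<le> c ^ 3 * real n" using c n by simp
      also have "\<dots> = c ^ 3 * (real n ^ 2 * q ^ 3) * real n" using q by simp
      also have "\<dots> = real n ^ 3 * p ^ 3" by (simp add: pq eval_nat_numeral)
      finally show ?thesis .
    qed
    moreover have "c \<le> real n ^ 4 * p ^ 6"
    proof -
      have "c \<le> c ^ 6 * (real n ^ 2 * q ^ 3) ^ 2" using cpow[of 6] q by simp
      also have "\<dots> = real n ^ 4 * p ^ 6" by (simp add: pq power_mult_distrib flip: power_mult)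
      finally show ?thesis .
    qed
    ultimately have "c \<le> real n ^ k * p ^ (k choose 2)" using that by (auto simp: choose_two)
    then show ?thesis using c by (intro divide_left_mono) auto
  qed
  then have "(\<Sum>k\<in>{2,3,4}. 1 / (real n ^ k * p ^ (k choose 2))) \<le> (\<Sum>k\<in>{2,3,4::nat}. 1 / c)"
    by (rule sum_mono)
  then have "?P ?N \<le> 12288 / c"
    using gnp_prob_no_K4[OF p0 p(2) n] by simp
  moreover have "1 - ?P ?N \<le> ?P {G. arrows G TT3}"
  proof -
    have "1 - ?P ?N = ?P (UNIV - ?N)" using measure_pmf.prob_compl[of ?N "gnp n p"] by simp
    also have "\<dots> \<le> ?P {G. arrows G TT3}"
    proof (rule measure_pmf.finite_measure_mono_AE)
      show "AE G in measure_pmf (gnp n p). G \<in> UNIV - ?N \<longrightarrow> G \<in> {G. arrows G TT3}"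
        using gnp_support(1)[of _ n p] K4_arrows_TT3 by (auto simp: AE_measure_pmf_iff)
    qed simp
    finally show ?thesis .
  qed
  ultimately show ?thesis by simp
qed

lemma is_threshold_arrows_TT3: "is_threshold (\<lambda>n. real n powr (- 2 / 3)) (\<lambda>G. arrows G TT3)"
  unfolding is_threshold_def
proof (intro allI impI conjI)
  fix p :: "nat \<Rightarrow> real" assume p: "\<forall>n. 0 \<le> p n \<and> p n \<le> 1"
  define c where "c = (\<lambda>n. p n / real n powr (- 2 / 3))"
  have c0: "0 \<le> c n" for n using p by (simp add: c_def)
  \<comment> \<open>At n = 0 the power is 0, so \<open>c 0\<close> is 0 whatever \<open>p 0\<close>
    is; the limits are insensitive to this.\<close>
  have pc: "p n = c n * real n powr (- 2 / 3)" if "n \<ge> 1" for n using that by (simp add: c_def)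
  let ?P = "\<lambda>n. measure_pmf.prob (gnp n (p n)) {G. arrows G TT3}"
  {
    assume "(\<lambda>n. p n / real n powr (- 2 / 3)) \<longlonglongrightarrow> 0"
    then have c: "c \<longlonglongrightarrow> 0" by (simp add: c_def)
    show "?P \<longlonglongrightarrow> 0"
    proof (rule tendsto_sandwich[OF _ _ tendsto_const])
      show "(\<lambda>n. 2 ^ 6 * c n ^ 6 + 2 ^ 10 * c n ^ 8 + 2 ^ 15 * c n ^ 9) \<longlonglongrightarrow> 0"
        using c by (auto intro!: tendsto_eq_intros)
      show "\<forall>\<^sub>F n in sequentially. ?P n \<le> 2 ^ 6 * c n ^ 6 + 2 ^ 10 * c n ^ 8 + 2 ^ 15 * c n ^ 9"
        using eventually_ge_at_top[of 1]
        by eventually_elim (use gnp_prob_arrows_le c0 pc p in blast)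
    qed auto
  next
    assume "filterlim (\<lambda>n. p n / real n powr (- 2 / 3)) at_top sequentially"
    then have c: "filterlim c at_top sequentially" by (simp add: c_def)
    show "?P \<longlonglongrightarrow> 1"
    proof (rule tendsto_sandwich[OF _ _ _ tendsto_const])
      have "(\<lambda>n. 12288 / c n) \<longlonglongrightarrow> 0"
        using c by (intro real_tendsto_divide_at_top[OF tendsto_const])
      from tendsto_diff[OF tendsto_const this, of 1] show "(\<lambda>n. 1 - 12288 / c n) \<longlonglongrightarrow> 1" by simp
      \<comment> \<open>The lower bound applies only once the ratio has reached 1.\<close>
      have "\<forall>\<^sub>F n in sequentially. 1 \<le> c n" using c by (simp add: filterlim_at_top)
      with eventually_ge_at_top[of 4] show "\<forall>\<^sub>F n in sequentially. 1 - 12288 / c n \<le> ?P n"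
      proof eventually_elim
        case (elim n)
        then have "n \<ge> 1" by simp
        with elim pc p show ?case by (intro gnp_prob_arrows_ge) blast+
      qed
    qed auto
  }
qed

text \<open>The maximum density of K4 is (4 - 1) / 2 = 3/2, which gives the exponent -2/3.\<close>

theorem theorem8:
  "(\<forall>n::nat. real n powr (- 1 / max_density (complete_graph 4)) = real n powr (- 2 / 3)) \<and>
   is_threshold (\<lambda>n. real n powr (- 1 / max_density (complete_graph 4))) (\<lambda>G. arrows G TT3)"
  using is_threshold_arrows_TT3 by (simp add: max_density_complete_graph)

end
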